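(* Let $\mathbb{P}$ and $\mathbb{Q}$ be posets and let $\rho\subseteq\mathbb{Q}\times\mathbb{P}$ and $\sigma\subseteq\mathbb{P}\times\mathbb{Q}$ be refiners satisfying \[\rho\circ\sigma\ \subseteq\ \succsim_{\mathbb{Q}}\qquad\text{and}\qquad\sigma\circ\rho\ \subseteq\ \succsim_{\mathbb{P}}.\] For $S\subseteq\mathbb{P}$ put $\rho[S]=\{q\in\mathbb{Q}:\exists p\in S\ (q\,\rho\,p)\}$ and for $T\subseteq\mathbb{Q}$ put $\sigma[T]=\{p\in\mathbb{P}:\exists q\in T\ (p\,\sigma\,q)\}$. Then $S\mapsto\rho[S]$ and $T\mapsto\sigma[T]$ are continuous maps between $\mathsf{S}\mathbb{P}$ and $\mathsf{S}\mathbb{Q}$ (from $\mathsf{S}\mathbb{P}$ to $\mathsf{S}\mathbb{Q}$ and from $\mathsf{S}\mathbb{Q}$ to $\mathsf{S}\mathbb{P}$ respectively) satisfying \[S=\sigma[\rho[S]]\qquad\text{and}\qquad T=\rho[\sigma[T]]\] for all $S\in\mathsf{S}\mathbb{P}$ and $T\in\mathsf{S}\mathbb{Q}$.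
   Context: Let $(\mathbb{P},\leq)$ be a poset. A subset $S\subseteq\mathbb{P}$ refines $T\subseteq\mathbb{P}$ if for every $s\in S$ there is $t\in T$ with $s\leq t$. A band of $\mathbb{P}$ is a finite subset $B\subseteq\mathbb{P}$ such that every $p\in\mathbb{P}$ is comparable to some $b\in B$. A cap of $\mathbb{P}$ is a subset refined by some band. A selector is a subset $S\subseteq\mathbb{P}$ with $S\cap C\neq\emptyset$ for every cap $C$ of $\mathbb{P}$; a minimal selector is one minimal with respect to inclusion among all selectors. The spectrum $\mathsf{S}\mathbb{P}$ is the set of all minimal selectors, with the topology generated by the subbasis consisting of the sets $p^\in=\{S\in\mathsf{S}\mathbb{P}:p\in S\}$, for $p\in\mathbb{P}$. The relation $\succsim_{\mathbb{P}}\ \subseteq\mathbb{P}\times\mathbb{P}$ is defined by: $p\succsim_{\mathbb{P}}p'$ if for all $F\subseteq\mathbb{P}$, whenever $F\cup\{p'\}$ is a cap of $\mathbb{P}$, so is $F\cup\{p\}$ (equivalently, $p^\in\supseteq p'^\in$); $\succsim_{\mathbb{Q}}$ is defined likewise. A relation $\rho\subseteq\mathbb{Q}\times\mathbb{P}$ between posets is a refiner if for every cap $D$ of $\mathbb{Q}$ there is a cap $C$ of $\mathbb{P}$ such that for every $c\in C$ there is $d\in D$ with $d\,\rho\,c$. Composition of relations is $\rho\circ\sigma=\{(q,q'):\exists p\ (q\,\rho\,p\text{ and }p\,\sigma\,q')\}$. *)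

theory Defs
  imports "HOL-Analysis.Analysis"
begin

text \<open>
  A poset is a carrier set \<open>P\<close> with \<open>partial_order_on P r\<close>, where \<open>(p, q) \<in> r\<close> means
  \<open>p \<le> q\<close>. Carrier sets rather than types of class \<^class>\<open>order\<close> are used so that the empty
  poset is included.
\<close>

definition refines :: "'a rel \<Rightarrow> 'a set \<Rightarrow> 'a set \<Rightarrow> bool" where
  "refines r S T \<longleftrightarrow> (\<forall>s\<in>S. \<exists>t\<in>T. (s, t) \<in> r)"

definition band :: "'a set \<Rightarrow> 'a rel \<Rightarrow> 'a set \<Rightarrow> bool" where
  "band P r B \<longleftrightarrow>
     finite B \<and> B \<subseteq> P \<and> (\<forall>p\<in>P. \<exists>b\<in>B. (p, b) \<in> r \<or> (b, p) \<in> r)"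

definition cap :: "'a set \<Rightarrow> 'a rel \<Rightarrow> 'a set \<Rightarrow> bool" where
  "cap P r C \<longleftrightarrow> C \<subseteq> P \<and> (\<exists>B. band P r B \<and> refines r B C)"

definition selector :: "'a set \<Rightarrow> 'a rel \<Rightarrow> 'a set \<Rightarrow> bool" where
  "selector P r S \<longleftrightarrow> S \<subseteq> P \<and> (\<forall>C. cap P r C \<longrightarrow> S \<inter> C \<noteq> {})"

definition minimal_selector :: "'a set \<Rightarrow> 'a rel \<Rightarrow> 'a set \<Rightarrow> bool" where
  "minimal_selector P r S \<longleftrightarrow>
     selector P r S \<and> (\<forall>T. selector P r T \<and> T \<subseteq> S \<longrightarrow> T = S)"

definition spectrum :: "'a set \<Rightarrow> 'a rel \<Rightarrow> 'a set set" where
  "spectrum P r = {S. minimal_selector P r S}"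

definition spectrum_sub :: "'a set \<Rightarrow> 'a rel \<Rightarrow> 'a \<Rightarrow> 'a set set" where
  "spectrum_sub P r p = {S \<in> spectrum P r. p \<in> S}"

text \<open>
  The whole space is the empty intersection of subbasic sets, but
  \<^const>\<open>topology_generated_by\<close> takes the union of the generating sets as its underlying
  space, so the whole space is added explicitly. This matters only if \<open>P\<close> has no band: then
  there are no caps, the empty set is the only minimal selector, and no subbasic set contains it.
\<close>

definition spectrum_topology :: "'a set \<Rightarrow> 'a rel \<Rightarrow> 'a set topology" where
  "spectrum_topology P r =
     topology_generated_by (insert (spectrum P r) (spectrum_sub P r ` P))"

lemma topspace_spectrum_topology [simp]:
  "topspace (spectrum_topology P r) = spectrum P r"
  by (auto simp: spectrum_topology_def spectrum_sub_def)

definition cap_ge :: "'a set \<Rightarrow> 'a rel \<Rightarrow> 'a rel" where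
  "cap_ge P r = {(p, p'). p \<in> P \<and> p' \<in> P \<and>
     (\<forall>F. F \<subseteq> P \<and> cap P r (F \<union> {p'}) \<longrightarrow> cap P r (F \<union> {p}))}"

text \<open>
  \<open>refiner Q s P r \<rho>\<close>: the relation \<open>\<rho> \<subseteq> Q \<times> P\<close> is a refiner between the posets \<open>(Q, s)\<close> and
  \<open>(P, r)\<close>. For such \<open>\<rho>\<close> and \<open>S \<subseteq> P\<close>, the set of all \<open>q\<close> with \<open>(q, p) \<in> \<rho>\<close> for some
  \<open>p \<in> S\<close> is \<open>\<rho>\<inverse> `` S\<close>.
\<close>

definition refiner :: "'b set \<Rightarrow> 'b rel \<Rightarrow> 'a set \<Rightarrow> 'a rel \<Rightarrow> ('b \<times> 'a) set \<Rightarrow> bool" where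
  "refiner Q s P r \<rho> \<longleftrightarrow> \<rho> \<subseteq> Q \<times> P \<and>
     (\<forall>D. cap Q s D \<longrightarrow> (\<exists>C. cap P r C \<and> (\<forall>c\<in>C. \<exists>d\<in>D. (d, c) \<in> \<rho>)))"

end

theory Submission
  imports Defs
begin

text \<open>
  The key point is that minimal selectors respect \<open>\<succsim>\<close>: each of their
  points is isolated by some cap, so they are closed under passing from \<open>p'\<close> to any \<open>p\<close>
  with \<open>p \<succsim> p'\<close> (\<open>minimal_selector_cap_ge_closed\<close>). Refiners are exactly what is needed to push
  selectors to selectors (\<open>selector_image_refiner\<close>), but the image of a minimal selector need not
  be minimal in general.

  Here minimality comes from the two composition hypotheses. Let \<open>S\<close> be a minimal selector of
  \<open>P\<close>. By compactness (\<open>selector_contains_minimal\<close>) the selector \<open>\<rho>[S]\<close> contains a minimal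
  selector \<open>T\<close>. Closedness of \<open>S\<close> gives \<open>\<sigma>[T] \<subseteq> \<sigma>[\<rho>[S]] \<subseteq> S\<close>, and as \<open>\<sigma>[T]\<close> is a selector,
  minimality of \<open>S\<close> turns both inclusions into equalities. Closedness of \<open>T\<close> then gives
  \<open>\<rho>[S] = \<rho>[\<sigma>[T]] \<subseteq> T\<close>, so \<open>\<rho>[S] = T\<close> is minimal. Continuity holds because the preimage of
  the subbasic set of \<open>q\<close> is the union of the subbasic sets of those \<open>p\<close> with \<open>q \<rho> p\<close>.
\<close>

text \<open>
  Compactness in combinatorial form: a band is finite, so only finitely many elements of a cap are
  needed to lie above its members.
\<close>

lemma cap_contains_finite_cap:
  assumes "cap P r C"
  obtains F where "finite F" and "F \<subseteq> C" and "cap P r F"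
proof -
  obtain B where B: "band P r B" "refines r B C" and "C \<subseteq> P"
    using assms unfolding cap_def by blast
  then obtain f where f: "\<And>b. b \<in> B \<Longrightarrow> f b \<in> C \<and> (b, f b) \<in> r"
    unfolding refines_def by metis
  show thesis
  proof
    show "finite (f ` B)" using B(1) unfolding band_def by simp
    show "f ` B \<subseteq> C" using f by blast
    then show "cap P r (f ` B)"
      using B(1) f \<open>C \<subseteq> P\<close> unfolding cap_def refines_def by blast
  qed
qed

text \<open>
  Zorn's lemma, applied to the sets that can be removed from \<open>S\<close>. A union of a chain of removable
  sets is removable: a cap met by none of the remaining points may be taken finite, and its finitely
  many points of \<open>S\<close> would already be removed by one member of the chain.
\<close>

lemma selector_contains_minimal:
  assumes "selector P r S"
  obtains T where "minimal_selector P r T" and "T \<subseteq> S"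
proof -
  let ?A = "{X. X \<subseteq> S \<and> selector P r (S - X)}"
  have "\<Union>\<C> \<in> ?A" if "\<C> \<noteq> {}" and chain: "subset.chain ?A \<C>" for \<C>
  proof -
    have mem: "X \<subseteq> S" "selector P r (S - X)" if "X \<in> \<C>" for X
      using chain that unfolding subset.chain_def by auto
    have "(S - \<Union>\<C>) \<inter> C \<noteq> {}" if C: "cap P r C" for C
    proof
      assume empty: "(S - \<Union>\<C>) \<inter> C = {}"
      obtain F where F: "finite F" "F \<subseteq> C" "cap P r F"
        using cap_contains_finite_cap[OF C] .
      have "finite (S \<inter> F)" "S \<inter> F \<subseteq> \<Union>\<C>"
        using F empty by auto
      then obtain X where "X \<in> \<C>" "S \<inter> F \<subseteq> X"
        using finite_subset_Union_chain[OF _ _ \<open>\<C> \<noteq> {}\<close> chain] by blast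
      then show False
        using mem(2)[OF \<open>X \<in> \<C>\<close>] F(3) unfolding selector_def by blast
    qed
    moreover have "S \<subseteq> P" using assms unfolding selector_def by blast
    ultimately show ?thesis
      using mem(1) unfolding selector_def by blast
  qed
  moreover have "{} \<in> ?A" using assms by simp
  ultimately obtain M where M: "M \<in> ?A" and max: "\<forall>X\<in>?A. M \<subseteq> X \<longrightarrow> X = M"
    using subset_Zorn_nonempty[of ?A] by blast
  have "T = S - M" if "selector P r T" "T \<subseteq> S - M" for T
  proof -
    have "S - (S - T) = T" using that(2) by blast
    then have "S - T \<in> ?A" using that(1) by auto
    moreover have "M \<subseteq> S - T" using M that(2) by blast
    ultimately have "S - T = M" using max by blast
    then show ?thesis using that(2) by blast
  qed
  then have "minimal_selector P r (S - M)"
    using M unfolding minimal_selector_def by blast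
  then show thesis using that by blast
qed

text \<open>If every cap met \<open>S\<close> away from \<open>p\<close>, then \<open>S - {p}\<close> would be a smaller selector.\<close>

lemma minimal_selector_isolating_cap:
  assumes "minimal_selector P r S" and "p \<in> S"
  obtains C where "cap P r C" and "S \<inter> C = {p}"
proof -
  have "selector P r S" using assms(1) unfolding minimal_selector_def by blast
  moreover have "\<not> selector P r (S - {p})"
    using assms unfolding minimal_selector_def by blast
  ultimately obtain C where "cap P r C" "S \<inter> C \<noteq> {}" "(S - {p}) \<inter> C = {}"
    unfolding selector_def by blast
  then show thesis using that[of C] by blast
qed

text \<open>
  In a cap where \<open>p'\<close> is the only point of \<open>S\<close>, replace \<open>p'\<close> by \<open>p\<close>: the result is still a
  cap, and \<open>p\<close> is the only point where \<open>S\<close> can meet it.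
\<close>

lemma minimal_selector_cap_ge_closed:
  assumes "minimal_selector P r S" and "p' \<in> S" and "(p, p') \<in> cap_ge P r"
  shows "p \<in> S"
proof -
  obtain C where C: "cap P r C" "S \<inter> C = {p'}"
    using minimal_selector_isolating_cap[OF assms(1,2)] .
  let ?F = "C - {p'}"
  have "?F \<union> {p'} = C" using C(2) by blast
  then have "cap P r (?F \<union> {p'})" using C(1) by simp
  moreover have "?F \<subseteq> P" using C(1) unfolding cap_def by blast
  ultimately have "cap P r (?F \<union> {p})" using assms(3) unfolding cap_ge_def by blast
  then have "S \<inter> (?F \<union> {p}) \<noteq> {}"
    using assms(1) unfolding minimal_selector_def selector_def by blast
  then show ?thesis using C(2) by blast
qed

lemma selector_image_refiner:
  assumes "refiner Q s P r \<rho>" and "selector P r S"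
  shows "selector Q s (\<rho>\<inverse> `` S)"
  unfolding selector_def
proof (intro conjI allI impI)
  show "\<rho>\<inverse> `` S \<subseteq> Q" using assms(1) unfolding refiner_def by blast
next
  fix D assume "cap Q s D"
  then obtain C where C: "cap P r C" "\<forall>c\<in>C. \<exists>d\<in>D. (d, c) \<in> \<rho>"
    using assms(1) unfolding refiner_def by blast
  then obtain c where "c \<in> S" "c \<in> C" using assms(2) unfolding selector_def by blast
  then show "\<rho>\<inverse> `` S \<inter> D \<noteq> {}" using C(2) by blast
qed

lemma spectrum_image_image_subset:
  assumes "S \<in> spectrum P r" and "\<sigma> O \<rho> \<subseteq> cap_ge P r"
  shows "\<sigma>\<inverse> `` (\<rho>\<inverse> `` S) \<subseteq> S"
  using assms minimal_selector_cap_ge_closed[of P r S] unfolding spectrum_def by blast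

text \<open>
  A pair of refiners inverse to each other up to \<open>\<succsim>\<close> preserves minimality: the intermediate minimal
  selector \<open>T \<subseteq> \<rho>[S]\<close> turns out to be all of \<open>\<rho>[S]\<close>.
\<close>

lemma spectrum_image_refiner:
  assumes "refiner Q s P r \<rho>" and "refiner P r Q s \<sigma>"
    and "\<rho> O \<sigma> \<subseteq> cap_ge Q s" and "\<sigma> O \<rho> \<subseteq> cap_ge P r"
    and "S \<in> spectrum P r"
  shows "\<rho>\<inverse> `` S \<in> spectrum Q s" and "\<sigma>\<inverse> `` (\<rho>\<inverse> `` S) = S"
proof -
  have min_S: "minimal_selector P r S" using assms(5) unfolding spectrum_def by simp
  then have "selector P r S" unfolding minimal_selector_def by blast
  then obtain T where min_T: "minimal_selector Q s T" and T: "T \<subseteq> \<rho>\<inverse> `` S"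
    using selector_contains_minimal[OF selector_image_refiner[OF assms(1)]] by blast
  have "selector P r (\<sigma>\<inverse> `` T)"
    using min_T selector_image_refiner[OF assms(2)] unfolding minimal_selector_def by blast
  moreover have le: "\<sigma>\<inverse> `` (\<rho>\<inverse> `` S) \<subseteq> S"
    using assms(5,4) by (rule spectrum_image_image_subset)
  moreover have mono: "\<sigma>\<inverse> `` T \<subseteq> \<sigma>\<inverse> `` (\<rho>\<inverse> `` S)" using T by blast
  ultimately have S: "\<sigma>\<inverse> `` T = S"
    using min_S unfolding minimal_selector_def by blast
  then show "\<sigma>\<inverse> `` (\<rho>\<inverse> `` S) = S" using le mono by blast
  have T_spec: "T \<in> spectrum Q s" using min_T unfolding spectrum_def by simp
  have "\<rho>\<inverse> `` S \<subseteq> T" using spectrum_image_image_subset[OF T_spec assms(3)] S by simp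
  then have "\<rho>\<inverse> `` S = T" using T by blast
  then show "\<rho>\<inverse> `` S \<in> spectrum Q s" using T_spec by simp
qed

lemma openin_spectrum_sub:
  "p \<in> P \<Longrightarrow> openin (spectrum_topology P r) (spectrum_sub P r p)"
  unfolding spectrum_topology_def by (rule topology_generated_by_Basis) simp

text \<open>
  A relation acts on sets by unions, and \<open>q \<in> \<rho>[S]\<close> says that \<open>S\<close> contains some \<open>p\<close> with
  \<open>q \<rho> p\<close>. So continuity is automatic as soon as the map lands in the spectrum.
\<close>

lemma continuous_map_spectrum_image:
  assumes "\<rho> \<subseteq> Q \<times> P" and "\<And>S. S \<in> spectrum P r \<Longrightarrow> \<rho>\<inverse> `` S \<in> spectrum Q s"
  shows "continuous_map (spectrum_topology P r) (spectrum_topology Q s) (\<lambda>S. \<rho>\<inverse> `` S)"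
proof -
  let ?f = "\<lambda>S. \<rho>\<inverse> `` S"
  have "openin (spectrum_topology P r) (?f -` U \<inter> spectrum P r)"
    if U: "U \<in> insert (spectrum Q s) (spectrum_sub Q s ` Q)" for U
  proof (cases "U = spectrum Q s")
    case True
    then have "?f -` U \<inter> spectrum P r = topspace (spectrum_topology P r)"
      using assms(2) by auto
    then show ?thesis using openin_topspace by metis
  next
    case False
    then obtain q where q: "U = spectrum_sub Q s q" using U by blast
    have "?f -` U \<inter> spectrum P r = (\<Union>p\<in>{p. (q, p) \<in> \<rho>}. spectrum_sub P r p)"
      unfolding q spectrum_sub_def using assms(2) by auto
    also have "openin (spectrum_topology P r) \<dots>"
      using assms(1) by (intro openin_Union) (auto intro: openin_spectrum_sub)
    finally show ?thesis .
  qed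
  then show ?thesis
    unfolding spectrum_topology_def[of Q s] continuous_on_generated_topo_iff
    using assms(2) by auto
qed

theorem proposition3p7:
  fixes P :: "'a set" and r :: "'a rel" and Q :: "'b set" and s :: "'b rel"
    and \<rho> :: "('b \<times> 'a) set" and \<sigma> :: "('a \<times> 'b) set"
  assumes "partial_order_on P r" and "partial_order_on Q s"
    and "refiner Q s P r \<rho>" and "refiner P r Q s \<sigma>"
    and "\<rho> O \<sigma> \<subseteq> cap_ge Q s" and "\<sigma> O \<rho> \<subseteq> cap_ge P r"
  shows "continuous_map (spectrum_topology P r) (spectrum_topology Q s) (\<lambda>S. \<rho>\<inverse> `` S) \<and>
    continuous_map (spectrum_topology Q s) (spectrum_topology P r) (\<lambda>T. \<sigma>\<inverse> `` T) \<and>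
    (\<forall>S\<in>spectrum P r. S = \<sigma>\<inverse> `` (\<rho>\<inverse> `` S)) \<and>
    (\<forall>T\<in>spectrum Q s. T = \<rho>\<inverse> `` (\<sigma>\<inverse> `` T))"
proof -
  note to_Q = spectrum_image_refiner[OF assms(3,4,5,6)]
    and to_P = spectrum_image_refiner[OF assms(4,3,6,5)]
  have "\<rho> \<subseteq> Q \<times> P" "\<sigma> \<subseteq> P \<times> Q"
    using assms(3,4) unfolding refiner_def by blast+
  then show ?thesis
    using continuous_map_spectrum_image[of \<rho> Q P r s] continuous_map_spectrum_image[of \<sigma> P Q s r]
      to_Q to_P by simp
qed

end
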